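(* For every special $\Pi^0_1$ set $P\subseteq2^{\mathbb N}$, there exists a $\Pi^0_1$ set $Q\subseteq2^{\mathbb N}$ such that $Q<^1_1P$ and $Q\equiv^1_{<\omega}P$.
   Context: A set is special if it is nonempty and contains no computable element. Let $\{\Phi_e\}_{e\in\mathbb N}$ be an effective enumeration of all partial computable functions $\Phi_e:\subseteq\mathbb N^{\mathbb N}\to\mathbb N^{\mathbb N}$. A learner is a total computable function $\Psi:\mathbb N^{<\mathbb N}\to\mathbb N$. A partial function $\Gamma:\subseteq\mathbb N^{\mathbb N}\to\mathbb N^{\mathbb N}$ is $(1,1)$-computable if it is computable. It is $(1,<\omega)$-computable if there is a learner $\Psi$ such that for every $g\in\mathrm{dom}(\Gamma)$ the limit $\lim_n\Psi(g\upharpoonright n)$ exists and $\Phi_{\lim_n\Psi(g\upharpoonright n)}(g)=\Gamma(g)$, and $\sup_{g\in\mathrm{dom}(\Gamma)}\#\{n:\Psi(g\upharpoonright(n+1))\neq\Psi(g\upharpoonright n)\}<\omega$. For $A,B\subseteq\mathbb N^{\mathbb N}$, $A\le^\alpha_\beta B$ means there is an $(\alpha,\beta)$-computable partial function $\Gamma$ with $B\subseteq\mathrm{dom}(\Gamma)$ and $\Gamma(g)\in A$ for every $g\in B$. $A<^\alpha_\beta B$ means $A\le^\alpha_\beta B$ and $B\not\le^\alpha_\beta A$; $A\equiv^\alpha_\beta B$ means both reductions hold. *)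

theory Defs
  imports Complex_Main "HOL-Library.Nat_Bijection"
begin

type_synonym baire = "nat \<Rightarrow> nat"

section \<open>Partial recursive functions with an oracle\<close>

text \<open>
  Programs for the partial functions on the natural numbers that are recursive in an oracle
  (Kleene's schemata). All functions are unary; several arguments are passed through the pairing
  function \<^const>\<open>prod_encode\<close>, so that projections and pairing replace argument tuples.
\<close>

datatype prog =
    Zero
  | Succ
  | First
  | Second
  | Oracle
  | Pair prog prog
  | Comp prog prog
  | Prec prog prog
  | Mu prog

text \<open>
  \<open>run c g x\<close> is the value of program \<open>c\<close> with oracle \<open>g\<close> on input \<open>x\<close>, and \<^const>\<open>None\<close> if the
  computation diverges. In the last clause the search succeeds only if the subprogram
  converges on all arguments up to the first zero.
\<close>

primrec run :: "prog \<Rightarrow> baire \<Rightarrow> nat \<Rightarrow> nat option" where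
  "run Zero g x = Some 0"
| "run Succ g x = Some (Suc x)"
| "run First g x = Some (fst (prod_decode x))"
| "run Second g x = Some (snd (prod_decode x))"
| "run Oracle g x = Some (g x)"
| "run (Pair c d) g x =
     Option.bind (run c g x) (\<lambda>u. Option.bind (run d g x) (\<lambda>v. Some (prod_encode (u, v))))"
| "run (Comp c d) g x = Option.bind (run d g x) (run c g)"
| "run (Prec c d) g x =
     (case prod_decode x of (a, n) \<Rightarrow>
        rec_nat (run c g a)
          (\<lambda>m r. Option.bind r (\<lambda>v. run d g (prod_encode (a, prod_encode (m, v))))) n)"
| "run (Mu c) g x =
     (if \<exists>n. run c g (prod_encode (x, n)) = Some 0 \<and> (\<forall>m<n. run c g (prod_encode (x, m)) \<noteq> None)
      then Some (LEAST n. run c g (prod_encode (x, n)) = Some 0) else None)"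

primrec oracle_free :: "prog \<Rightarrow> bool" where
  "oracle_free Zero = True"
| "oracle_free Succ = True"
| "oracle_free First = True"
| "oracle_free Second = True"
| "oracle_free Oracle = False"
| "oracle_free (Pair c d) = (oracle_free c \<and> oracle_free d)"
| "oracle_free (Comp c d) = (oracle_free c \<and> oracle_free d)"
| "oracle_free (Prec c d) = (oracle_free c \<and> oracle_free d)"
| "oracle_free (Mu c) = oracle_free c"

text \<open>The oracle \<open>\<lambda>_. 0\<close> below is a dummy: an oracle-free program never consults it.\<close>

definition computable :: "(nat \<Rightarrow> nat) \<Rightarrow> bool" where
  "computable f \<longleftrightarrow> (\<exists>c. oracle_free c \<and> (\<forall>n. run c (\<lambda>_. 0) n = Some (f n)))"

lemma run_oracle_free: "oracle_free c \<Longrightarrow> run c g = run c h"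
proof (induction c)
  case (Pair c d) then have "run c g = run c h" "run d g = run d h" by auto
  then show ?case by (intro ext) simp
next
  case (Comp c d) then have "run c g = run c h" "run d g = run d h" by auto
  then show ?case by (intro ext) simp
next
  case (Prec c d) then have "run c g = run c h" "run d g = run d h" by auto
  then show ?case by (intro ext) simp
next
  case (Mu c) then have "run c g = run c h" by auto
  then show ?case by (intro ext) simp
qed (auto intro!: ext)

definition computable_list :: "(nat list \<Rightarrow> nat) \<Rightarrow> bool" where
  "computable_list F \<longleftrightarrow> computable (\<lambda>k. F (list_decode k))"

definition computable_string_set :: "nat list set \<Rightarrow> bool" where
  "computable_string_set T \<longleftrightarrow> computable_list (\<lambda>\<sigma>. if \<sigma> \<in> T then 1 else 0)"

section \<open>Partial computable functions on Baire space and their enumeration\<close>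

definition functional_of :: "prog \<Rightarrow> baire \<rightharpoonup> baire" where
  "functional_of c g =
     (if \<forall>n. run c g n \<noteq> None then Some (\<lambda>n. the (run c g n)) else None)"

definition computable_functional :: "(baire \<rightharpoonup> baire) \<Rightarrow> bool" where
  "computable_functional \<Gamma> \<longleftrightarrow> (\<exists>c. \<Gamma> = functional_of c)"

primrec prog_encode :: "prog \<Rightarrow> nat" where
  "prog_encode Zero = 0"
| "prog_encode Succ = 1"
| "prog_encode First = 2"
| "prog_encode Second = 3"
| "prog_encode Oracle = 4"
| "prog_encode (Pair c d) = 5 + 4 * prod_encode (prog_encode c, prog_encode d)"
| "prog_encode (Comp c d) = 6 + 4 * prod_encode (prog_encode c, prog_encode d)"
| "prog_encode (Prec c d) = 7 + 4 * prod_encode (prog_encode c, prog_encode d)"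
| "prog_encode (Mu c) = 8 + 4 * prog_encode c"

lemma inj_prog_encode: "inj prog_encode"
proof (rule injI)
  fix c d :: prog
  show "prog_encode c = prog_encode d \<Longrightarrow> c = d"
  proof (induction c arbitrary: d)
    case Zero then show ?case by (cases d) auto
  next
    case Succ then show ?case by (cases d) auto
  next
    case First then show ?case by (cases d) auto
  next
    case Second then show ?case by (cases d) auto
  next
    case Oracle then show ?case by (cases d) auto
  next
    case (Pair c1 c2) from Pair.prems show ?case by (cases d) (auto intro: Pair.IH, presburger+)
  next
    case (Comp c1 c2) from Comp.prems show ?case by (cases d) (auto intro: Comp.IH, presburger+)
  next
    case (Prec c1 c2) from Prec.prems show ?case by (cases d) (auto intro: Prec.IH, presburger+)
  next
    case (Mu c) from Mu.prems show ?case by (cases d) (auto intro: Mu.IH, presburger+)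
  qed
qed

lemma surj_prog_encode: "surj prog_encode"
proof -
  have "\<exists>c. prog_encode c = n" for n
  proof (induction n rule: less_induct)
    case (less n)
    consider "n = 0" | "n = 1" | "n = 2" | "n = 3" | "n = 4"
      | m where "n = 5 + 4 * m" | m where "n = 6 + 4 * m"
      | m where "n = 7 + 4 * m" | m where "n = 8 + 4 * m"
    proof -
      have "n < 5 \<or> (\<exists>m. n = 5 + 4 * m) \<or> (\<exists>m. n = 6 + 4 * m) \<or>
          (\<exists>m. n = 7 + 4 * m) \<or> (\<exists>m. n = 8 + 4 * m)"
        by presburger
      moreover have "n = 0 \<or> n = 1 \<or> n = 2 \<or> n = 3 \<or> n = 4" if "n < 5"
        using that by linarith
      ultimately show ?thesis using that by blast
    qed
    moreover have unpair: "\<exists>c d. m = prod_encode (prog_encode c, prog_encode d)" if "m < n" for m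
    proof -
      obtain a b where m: "m = prod_encode (a, b)"
        by (metis prod_decode_inverse surj_pair)
      with that have "a < n" "b < n"
        using le_prod_encode_1[of a b] le_prod_encode_2[of b a] by linarith+
      with less.IH m show ?thesis by blast
    qed
    ultimately show ?case
    proof cases
      case 1 then show ?thesis by (intro exI[of _ Zero]) simp
    next
      case 2 then show ?thesis by (intro exI[of _ Succ]) simp
    next
      case 3 then show ?thesis by (intro exI[of _ First]) simp
    next
      case 4 then show ?thesis by (intro exI[of _ Second]) simp
    next
      case 5 then show ?thesis by (intro exI[of _ Oracle]) simp
    next
      case (6 m)
      then have "m < n" by simp
      with unpair obtain c d where "m = prod_encode (prog_encode c, prog_encode d)" by blast
      with 6 show ?thesis by (intro exI[of _ "Pair c d"]) simp
    next
      case (7 m)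
      then have "m < n" by simp
      with unpair obtain c d where "m = prod_encode (prog_encode c, prog_encode d)" by blast
      with 7 show ?thesis by (intro exI[of _ "Comp c d"]) simp
    next
      case (8 m)
      then have "m < n" by simp
      with unpair obtain c d where "m = prod_encode (prog_encode c, prog_encode d)" by blast
      with 8 show ?thesis by (intro exI[of _ "Prec c d"]) simp
    next
      case (9 m)
      then have "m < n" by simp
      with less.IH obtain c where "prog_encode c = m" by blast
      with 9 show ?thesis by (intro exI[of _ "Mu c"]) simp
    qed
  qed
  then show ?thesis unfolding surj_def by metis
qed

text \<open>
  As \<^const>\<open>prog_encode\<close> is a bijection given by explicit arithmetic, its inverse is a computable
  decoding, and \<open>Phi\<close> is an effective enumeration.
\<close>

definition Phi :: "nat \<Rightarrow> baire \<rightharpoonup> baire" where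
  "Phi e = functional_of (inv prog_encode e)"

lemma range_Phi: "range Phi = Collect computable_functional"
proof -
  have "functional_of c = Phi (prog_encode c)" for c
    by (simp add: Phi_def inj_prog_encode)
  then show ?thesis
    unfolding computable_functional_def by (auto simp: Phi_def)
qed

section \<open>Learners and reducibilities\<close>

definition initial_segment :: "baire \<Rightarrow> nat \<Rightarrow> nat list" where
  "initial_segment g n = map g [0..<n]"

definition learnable_bounded :: "(baire \<rightharpoonup> baire) \<Rightarrow> bool" where
  "learnable_bounded \<Gamma> \<longleftrightarrow>
     (\<exists>\<Psi>. computable_list \<Psi> \<and>
       (\<forall>g\<in>dom \<Gamma>. convergent (\<lambda>n. \<Psi> (initial_segment g n)) \<and>
                  Phi (lim (\<lambda>n. \<Psi> (initial_segment g n))) g = \<Gamma> g) \<and>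
       (\<exists>b. \<forall>g\<in>dom \<Gamma>.
          finite {n. \<Psi> (initial_segment g (n + 1)) \<noteq> \<Psi> (initial_segment g n)} \<and>
          card {n. \<Psi> (initial_segment g (n + 1)) \<noteq> \<Psi> (initial_segment g n)} \<le> b))"

text \<open>
  The reducibility \<open>A \<le> B\<close> given by a class \<open>C\<close> of partial functions; the functions map
  elements of the right-hand set to elements of the left-hand set.
\<close>

definition reducible_via :: "((baire \<rightharpoonup> baire) \<Rightarrow> bool) \<Rightarrow> baire set \<Rightarrow> baire set \<Rightarrow> bool" where
  "reducible_via C A B \<longleftrightarrow> (\<exists>\<Gamma>. C \<Gamma> \<and> B \<subseteq> dom \<Gamma> \<and> (\<forall>g\<in>B. the (\<Gamma> g) \<in> A))"

definition le_1_1 :: "baire set \<Rightarrow> baire set \<Rightarrow> bool" where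
  "le_1_1 = reducible_via computable_functional"

definition less_1_1 :: "baire set \<Rightarrow> baire set \<Rightarrow> bool" where
  "less_1_1 A B \<longleftrightarrow> le_1_1 A B \<and> \<not> le_1_1 B A"

definition le_1_finite :: "baire set \<Rightarrow> baire set \<Rightarrow> bool" where
  "le_1_finite = reducible_via learnable_bounded"

definition equiv_1_finite :: "baire set \<Rightarrow> baire set \<Rightarrow> bool" where
  "equiv_1_finite A B \<longleftrightarrow> le_1_finite A B \<and> le_1_finite B A"

section \<open>Effectively closed sets and special sets\<close>

definition cantor :: "baire set" where
  "cantor = {f. \<forall>n. f n \<in> {0, 1}}"

definition is_tree :: "nat list set \<Rightarrow> bool" where
  "is_tree T \<longleftrightarrow> (\<forall>\<sigma> \<tau>. \<sigma> @ \<tau> \<in> T \<longrightarrow> \<sigma> \<in> T)"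

definition paths :: "nat list set \<Rightarrow> baire set" where
  "paths T = {f. \<forall>n. initial_segment f n \<in> T}"

text \<open>Lightface \<open>\<Pi>\<^sup>0\<^sub>1\<close>: the sets of infinite paths through computable trees.\<close>

definition Pi01 :: "baire set \<Rightarrow> bool" where
  "Pi01 P \<longleftrightarrow> (\<exists>T. computable_string_set T \<and> is_tree T \<and> P = paths T)"

definition special :: "baire set \<Rightarrow> bool" where
  "special P \<longleftrightarrow> P \<noteq> {} \<and> (\<forall>f\<in>P. \<not> computable f)"

end

theory Submission
  imports Defs "HOL-Library.Sublist"
begin

text \<open>
  Let \<open>P\<close> be the set of paths of \<open>T\<close>. The witness \<open>restart T\<close> consists of \<open>P\<close> together with all
  \<open>s @ h\<close>, where \<open>h \<in> P\<close> and \<open>s\<close> is a binary string which has just left \<open>T\<close>. It contains \<open>P\<close>, and a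
  learner recovers an element of \<open>P\<close> with one mind change, when it sees the input leave \<open>T\<close>.

  Suppose that a program maps \<open>restart T\<close> into \<open>P\<close>, and let \<open>out s\<close> be its output on the finite
  oracle \<open>s\<close>. If \<open>s\<close> leaves \<open>T\<close>, then \<open>out s\<close> is extendible to an element of \<open>P\<close>, since \<open>s @ h\<close> is a
  legal input for every \<open>h \<in> P\<close>; and if \<open>y\<close> is extendible in \<open>P\<close>, then so is \<open>out (s @ y)\<close>. Hence
  all strings \<open>out (s1 @ out (s2 @ \<dots> out sk))\<close> with exit strings \<open>si\<close> are extendible, and
  appending a further \<open>s\<close> inside can only lengthen them. As \<open>P\<close> has no computable element, every
  path of \<open>T\<close> is approximated by exit strings, so a suitable next \<open>s\<close> always exists and can be
  found by search. In the limit this computes an element of \<open>P\<close>, a contradiction.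
\<close>

section \<open>Total functionals computed by programs\<close>

abbreviation pr1 :: "nat \<Rightarrow> nat" where "pr1 x \<equiv> fst (prod_decode x)"
abbreviation pr2 :: "nat \<Rightarrow> nat" where "pr2 x \<equiv> snd (prod_decode x)"

text \<open>The flag \<open>b\<close> tells whether the program may consult its oracle.\<close>

definition effective :: "bool \<Rightarrow> (baire \<Rightarrow> nat \<Rightarrow> nat) \<Rightarrow> bool" where
  "effective b F \<longleftrightarrow> (\<exists>c. (b \<or> oracle_free c) \<and> (\<forall>g x. run c g x = Some (F g x)))"

lemma effectiveI: "(b \<or> oracle_free c) \<Longrightarrow> (\<And>g x. run c g x = Some (F g x)) \<Longrightarrow> effective b F"
  unfolding effective_def by blast

text \<open>An oracle-free program has the same values for every oracle, so the fixed zero oracle in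
  \<open>computable\<close> may be replaced by an arbitrary \<open>g\<close>.\<close>

lemma computable_iff_effective: "computable f \<longleftrightarrow> effective False (\<lambda>g. f)"
  unfolding computable_def effective_def by (metis run_oracle_free)

lemma effective_comp:
  assumes "effective b F" "effective b G"
  shows "effective b (\<lambda>g x. F g (G g x))"
proof -
  obtain c where c: "b \<or> oracle_free c" "\<And>g x. run c g x = Some (F g x)"
    using assms(1) unfolding effective_def by blast
  obtain d where d: "b \<or> oracle_free d" "\<And>g x. run d g x = Some (G g x)"
    using assms(2) unfolding effective_def by blast
  show ?thesis by (rule effectiveI[of _ "Comp c d"]) (use c d in auto)
qed

lemma effective_mono: "effective False F \<Longrightarrow> effective b F"
  unfolding effective_def by auto

lemma effective_id: "effective b (\<lambda>g x. x)"
proof (rule effectiveI)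
  \<comment> \<open>The identity is not a primitive program; taking the input apart and pairing it
    again yields it.\<close>
  show "run (Pair First Second) g x = Some x" for g x by simp
qed simp

lemma effective_Suc: "effective b u \<Longrightarrow> effective b (\<lambda>g x. Suc (u g x))"
  by (rule effective_comp[of b "\<lambda>g x. Suc x"]) (rule effectiveI[of _ Succ], auto)

lemma effective_pr1: "effective b u \<Longrightarrow> effective b (\<lambda>g x. pr1 (u g x))"
  by (rule effective_comp[of b "\<lambda>g x. pr1 x"]) (rule effectiveI[of _ First], auto)

lemma effective_pr2: "effective b u \<Longrightarrow> effective b (\<lambda>g x. pr2 (u g x))"
  by (rule effective_comp[of b "\<lambda>g x. pr2 x"]) (rule effectiveI[of _ Second], auto)

lemma effective_oracle: "effective True u \<Longrightarrow> effective True (\<lambda>g x. g (u g x))"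
  by (rule effective_comp[of True "\<lambda>g x. g x"]) (rule effectiveI[of _ Oracle], auto)

lemma effective_prod_encode:
  assumes "effective b u" "effective b v"
  shows "effective b (\<lambda>g x. prod_encode (u g x, v g x))"
proof -
  obtain c where c: "b \<or> oracle_free c" "\<And>g x. run c g x = Some (u g x)"
    using assms(1) unfolding effective_def by blast
  obtain d where d: "b \<or> oracle_free d" "\<And>g x. run d g x = Some (v g x)"
    using assms(2) unfolding effective_def by blast
  show ?thesis by (rule effectiveI[of _ "Pair c d"]) (use c d in auto)
qed

lemma effective_const: "effective b (\<lambda>g x. k)"
proof (induction k)
  case 0 show ?case by (rule effectiveI[of _ Zero]) auto
next
  case (Suc k) then show ?case by (rule effective_Suc)
qed

text \<open>\<open>Prec\<close> passes to its step program the nested pair of parameter, counter and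
  previous value, which fixes the form of the second assumption. The parameter \<open>x\<close> is
  carried along because start value, step and number of rounds may all depend on it.\<close>

lemma effective_rec_nat:
  assumes "effective b f" "effective b (\<lambda>g z. h g (pr1 z) (pr1 (pr2 z)) (pr2 (pr2 z)))" "effective b n"
  shows "effective b (\<lambda>g x. rec_nat (f g x) (h g x) (n g x))"
proof -
  obtain c where c: "b \<or> oracle_free c" "\<And>g x. run c g x = Some (f g x)"
    using assms(1) unfolding effective_def by blast
  obtain d where d: "b \<or> oracle_free d"
    "\<And>g x. run d g x = Some (h g (pr1 x) (pr1 (pr2 x)) (pr2 (pr2 x)))"
    using assms(2) unfolding effective_def by blast
  have run_Prec: "run (Prec c d) g (prod_encode (x, k)) = Some (rec_nat (f g x) (h g x) k)" for g x k
    by (induction k) (auto simp: c d)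
  have "effective b (\<lambda>g z. rec_nat (f g (pr1 z)) (h g (pr1 z)) (pr2 z))"
  proof (rule effectiveI)
    show "run (Prec c d) g z = Some (rec_nat (f g (pr1 z)) (h g (pr1 z)) (pr2 z))" for g z
      using run_Prec[of g "pr1 z" "pr2 z"] by simp
  qed (use c d in auto)
  from effective_comp[OF this effective_prod_encode[OF effective_id assms(3)]]
  show ?thesis by simp
qed

lemmas effective_basic = effective_const effective_id effective_Suc effective_pr1 effective_pr2
  effective_prod_encode

section \<open>Case distinction, Boolean connectives and arithmetic\<close>

lemma effective_if:
  assumes "effective b (\<lambda>g x. of_bool (p g x))" "effective b u" "effective b v"
  shows "effective b (\<lambda>g x. if p g x then u g x else v g x)"
proof -
  \<comment> \<open>A recursion of zero or one rounds whose step ignores counter and previous value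
    acts as a case distinction.\<close>
  have "effective b (\<lambda>g x. rec_nat (v g x) (\<lambda>_ _. u g x) (of_bool (p g x)))"
    by (intro effective_rec_nat assms effective_basic effective_comp[OF assms(2)])
  moreover have "(\<lambda>g x. rec_nat (v g x) (\<lambda>_ _. u g x) (of_bool (p g x)))
      = (\<lambda>g x. if p g x then u g x else v g x)"
    by (auto simp: fun_eq_iff)
  ultimately show ?thesis by simp
qed

lemma effective_not:
  assumes "effective b (\<lambda>g x. of_bool (p g x))"
  shows "effective b (\<lambda>g x. of_bool (\<not> p g x))"
proof -
  have "effective b (\<lambda>g x. if p g x then 0 else 1)"
    by (intro effective_if assms effective_basic)
  moreover have "of_bool (\<not> q) = (if q then 0 else (1::nat))" for q by simp
  ultimately show ?thesis by simp
qed

lemma effective_conj: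
  assumes "effective b (\<lambda>g x. of_bool (p g x))" "effective b (\<lambda>g x. of_bool (q g x))"
  shows "effective b (\<lambda>g x. of_bool (p g x \<and> q g x))"
proof -
  have "effective b (\<lambda>g x. if p g x then of_bool (q g x) else 0)"
    by (intro effective_if assms effective_basic)
  moreover have "(if r then of_bool s else 0) = (of_bool (r \<and> s) :: nat)" for r s by simp
  ultimately show ?thesis by (simp only:)
qed

lemma effective_disj:
  assumes "effective b (\<lambda>g x. of_bool (p g x))" "effective b (\<lambda>g x. of_bool (q g x))"
  shows "effective b (\<lambda>g x. of_bool (p g x \<or> q g x))"
proof -
  have "effective b (\<lambda>g x. if p g x then 1 else of_bool (q g x))"
    by (intro effective_if assms effective_basic)
  moreover have "(if r then 1 else of_bool s) = (of_bool (r \<or> s) :: nat)" for r s by simp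
  ultimately show ?thesis by (simp only:)
qed

lemma effective_add:
  assumes "effective b u" "effective b v"
  shows "effective b (\<lambda>g x. u g x + v g x)"
proof -
  have eq: "rec_nat m (\<lambda>_ r. Suc r) n = m + n" for m n by (induction n) auto
  have "effective b (\<lambda>g x. rec_nat (u g x) (\<lambda>_ r. Suc r) (v g x))"
    by (intro effective_rec_nat assms effective_basic)
  then show ?thesis by (simp only: eq)
qed

lemma effective_diff:
  assumes "effective b u" "effective b v"
  shows "effective b (\<lambda>g x. u g x - v g x)"
proof -
  \<comment> \<open>The recursion that returns its counter is the predecessor; iterating it gives
    truncated subtraction.\<close>
  have pred: "rec_nat 0 (\<lambda>m _. m) n = n - 1" for n by (cases n) auto
  have eq: "rec_nat m (\<lambda>_ r. rec_nat 0 (\<lambda>m _. m) r) n = m - n" for m n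
    by (induction n) (auto simp: pred)
  have "effective b (\<lambda>g x. rec_nat (u g x) (\<lambda>_ r. rec_nat 0 (\<lambda>m _. m) r) (v g x))"
    by (intro effective_rec_nat assms effective_basic)
  then show ?thesis by (simp only: eq)
qed

lemma effective_eq_0:
  assumes "effective b u"
  shows "effective b (\<lambda>g x. of_bool (u g x = 0))"
proof -
  have eq: "1 - n = of_bool (n = 0)" for n :: nat by auto
  have "effective b (\<lambda>g x. 1 - u g x)" by (intro effective_diff effective_basic assms)
  then show ?thesis by (simp only: eq)
qed

lemma effective_le:
  assumes "effective b u" "effective b v"
  shows "effective b (\<lambda>g x. of_bool (u g x \<le> v g x))"
  using effective_eq_0[OF effective_diff[OF assms]] by simp

lemma effective_less:
  assumes "effective b u" "effective b v"
  shows "effective b (\<lambda>g x. of_bool (u g x < v g x))"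
  using effective_not[OF effective_le[OF assms(2,1)]] by (simp add: not_le)

section \<open>Unbounded and bounded search\<close>

lemma run_Mu:
  assumes "\<And>n. run c g (prod_encode (x, n)) = Some (of_bool (\<not> p n))" "\<exists>n. p n"
  shows "run (Mu c) g x = Some (LEAST n. p n)"
  using assms by simp

lemma effective_Least:
  assumes "effective b (\<lambda>g z. of_bool (p g (pr1 z) (pr2 z)))" "\<And>g x. \<exists>n. p g x n"
  shows "effective b (\<lambda>g x. LEAST n. p g x n)"
proof -
  obtain c where c: "b \<or> oracle_free c"
    "\<And>g x. run c g x = Some (of_bool (\<not> p g (pr1 x) (pr2 x)))"
    \<comment> \<open>\<open>Mu\<close> stops at a zero, so the program it searches with computes
      the negated predicate.\<close>
    using effective_not[OF assms(1)] unfolding effective_def by blast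
  show ?thesis
  proof (rule effectiveI)
    show "run (Mu c) g x = Some (LEAST n. p g x n)" for g x
      by (rule run_Mu) (use c assms(2) in auto)
  qed (use c in auto)
qed

text \<open>The extra disjunct \<open>N \<le> n\<close> makes the search always succeed; whether it
  stops below \<open>N\<close> then decides the bounded quantifier. This is how
  \<open>effective_ball\<close> stays within total functionals.\<close>

lemma Least_or_ge_iff:
  "(LEAST n. N \<le> n \<or> p n) < N \<longleftrightarrow> (\<exists>n<N. p n)" for N :: nat
proof
  assume "(LEAST n. N \<le> n \<or> p n) < N"
  moreover have "N \<le> (LEAST n. N \<le> n \<or> p n) \<or> p (LEAST n. N \<le> n \<or> p n)"
    by (rule LeastI[of _ N]) simp
  ultimately show "\<exists>n<N. p n" by fastforce
next
  assume "\<exists>n<N. p n"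
  then obtain n where "n < N" "p n" by blast
  then show "(LEAST n. N \<le> n \<or> p n) < N"
    using Least_le[of "\<lambda>n. N \<le> n \<or> p n" n] by simp
qed

lemma effective_ball:
  assumes "effective b (\<lambda>g z. of_bool (p g (pr1 z) (pr2 z)))" "effective b N"
  shows "effective b (\<lambda>g x. of_bool (\<forall>i<N g x. p g x i))"
proof -
  have "effective b (\<lambda>g x. LEAST i. N g x \<le> i \<or> \<not> p g x i)"
    by (intro effective_Least effective_disj effective_le effective_not effective_comp[OF assms(2)]
        effective_basic assms) auto
  from effective_not[OF effective_less[OF this assms(2)]] show ?thesis
    by (simp add: Least_or_ge_iff)
qed

lemmas effective_arith = effective_basic effective_if effective_not effective_conj effective_disj
  effective_add effective_diff effective_eq_0 effective_le effective_less

section \<open>Operations on coded strings\<close>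

text \<open>The default 0 makes access total; it also turns a finite string into its infinite
  extension by zeros, which is used in \<open>ex_exit_string\<close>.\<close>

definition nth0 :: "nat list \<Rightarrow> baire" where
  "nth0 xs n = (if n < length xs then xs ! n else 0)"

lemma list_encode_eq_0_iff [simp]: "list_encode xs = 0 \<longleftrightarrow> xs = []"
  by (cases xs) auto

lemma effective_Cons:
  assumes "effective b u" "effective b (\<lambda>g x. list_encode (xs g x))"
  shows "effective b (\<lambda>g x. list_encode (u g x # xs g x))"
  using assms by (simp add: effective_arith)

text \<open>The code 0 is the empty list and a positive code is the successor of a pair of head and
  tail, so \<open>tl\<close> is simple arithmetic on codes and \<open>drop\<close> iterates
  it.\<close>

lemma effective_drop:
  assumes "effective b n" "effective b (\<lambda>g x. list_encode (xs g x))"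
  shows "effective b (\<lambda>g x. list_encode (drop (n g x) (xs g x)))"
proof -
  have tl: "list_encode (tl ys) = (if list_encode ys = 0 then 0 else pr2 (list_encode ys - 1))" for ys
    by (cases ys) auto
  have eq: "rec_nat (list_encode ys) (\<lambda>_ r. if r = 0 then 0 else pr2 (r - 1)) k
      = list_encode (drop k ys)" for k ys
  proof (induction k)
    case (Suc k)
    have "drop (Suc k) ys = tl (drop k ys)" by (simp add: drop_Suc tl_drop)
    with Suc show ?case by (simp only: tl old.nat.simps)
  qed simp
  have "effective b (\<lambda>g x. rec_nat (list_encode (xs g x))
      (\<lambda>_ r. if r = 0 then 0 else pr2 (r - 1)) (n g x))"
    by (intro effective_rec_nat effective_arith assms)
  then show ?thesis by (simp only: eq)
qed

lemma effective_nth0: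
  assumes "effective b (\<lambda>g x. list_encode (xs g x))" "effective b n"
  shows "effective b (\<lambda>g x. nth0 (xs g x) (n g x))"
proof -
  \<comment> \<open>Past the end of the list the code is 0, and the first component of
    \<open>0 - 1\<close> is again 0, in agreement with the default of \<open>nth0\<close>.\<close>
  have zero: "pr1 0 = 0" using prod_encode_inverse[of "(0,0)"] by (simp add: prod_encode_def)
  have eq: "pr1 (list_encode (drop k ys) - 1) = nth0 ys k" for k ys
  proof (cases "k < length ys")
    case True
    then have "drop k ys = ys ! k # drop (Suc k) ys" by (simp add: Cons_nth_drop_Suc)
    with True show ?thesis by (simp add: nth0_def)
  qed (simp add: nth0_def zero)
  have "effective b (\<lambda>g x. pr1 (list_encode (drop (n g x) (xs g x)) - 1))"
    by (intro effective_arith effective_drop assms)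
  then show ?thesis by (simp only: eq)
qed

lemma effective_length:
  assumes "effective b (\<lambda>g x. list_encode (xs g x))"
  shows "effective b (\<lambda>g x. length (xs g x))"
proof -
  have eq: "(LEAST n. list_encode (drop n ys) = 0) = length ys" for ys
    by (auto intro: Least_equality)
  have "effective b (\<lambda>g x. LEAST n. list_encode (drop n (xs g x)) = 0)"
    by (intro effective_Least effective_arith effective_drop effective_comp[OF assms])
      (auto intro: exI[of _ "length _"])
  then show ?thesis by (simp only: eq)
qed

text \<open>Consing builds a list from its last entry, so round \<open>m\<close> of the recursion
  adds the entry with index \<open>k - Suc m\<close>, where \<open>k\<close> is the length.\<close>

lemma effective_map_upt:
  assumes "effective b (\<lambda>g z. f g (pr1 z) (pr2 z))" "effective b n"
  shows "effective b (\<lambda>g x. list_encode (map (f g x) [0..<n g x]))"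
proof -
  have *: "rec_nat 0 (\<lambda>m r. Suc (prod_encode (h (k - Suc m), r))) m = list_encode (map h [k - m..<k])"
    if "m \<le> k" for h k m
    using that
  proof (induction m)
    case (Suc m)
    then have "[k - Suc m..<k] = (k - Suc m) # [k - m..<k]"
      by (subst upt_conv_Cons) (auto simp: Suc_diff_Suc)
    with Suc show ?case by simp
  qed simp
  have eq: "rec_nat 0 (\<lambda>m r. Suc (prod_encode (h (k - Suc m), r))) k = list_encode (map h [0..<k])" for h k
    using *[of k k h] by simp
  have "effective b (\<lambda>g z. f g (pr1 z) (n g (pr1 z) - Suc (pr1 (pr2 z))))"
    using effective_comp[OF assms(1), of "\<lambda>g z. prod_encode (pr1 z, n g (pr1 z) - Suc (pr1 (pr2 z)))"]
    by (simp add: effective_arith effective_comp[OF assms(2)])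
  then have "effective b (\<lambda>g x. rec_nat 0 (\<lambda>m r. Suc (prod_encode (f g x (n g x - Suc m), r))) (n g x))"
    by (intro effective_rec_nat effective_arith assms)
  then show ?thesis by (simp only: eq)
qed

lemma effective_take:
  assumes "effective b n" "effective b (\<lambda>g x. list_encode (xs g x))"
  shows "effective b (\<lambda>g x. list_encode (take (n g x) (xs g x)))"
proof -
  have eq: "map (nth0 ys) [0..<if k \<le> length ys then k else length ys] = take k ys" for k ys
    by (rule nth_equalityI) (auto simp: nth0_def split: if_splits)
  have "effective b (\<lambda>g x. list_encode (map (nth0 (xs g x))
      [0..<if n g x \<le> length (xs g x) then n g x else length (xs g x)]))"
    by (intro effective_map_upt effective_arith effective_nth0 effective_length assms
        effective_comp[OF assms(2)])
  then show ?thesis by (simp only: eq)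
qed

lemma effective_append:
  assumes "effective b (\<lambda>g x. list_encode (xs g x))" "effective b (\<lambda>g x. list_encode (ys g x))"
  shows "effective b (\<lambda>g x. list_encode (xs g x @ ys g x))"
proof -
  have eq: "map (\<lambda>i. if i < length us then nth0 us i else nth0 vs (i - length us))
      [0..<length us + length vs] = us @ vs" for us vs
    by (rule nth_equalityI) (auto simp: nth0_def nth_append)
  have "effective b (\<lambda>g x. list_encode (map (\<lambda>i. if i < length (xs g x) then nth0 (xs g x) i
      else nth0 (ys g x) (i - length (xs g x))) [0..<length (xs g x) + length (ys g x)]))"
    by (intro effective_map_upt effective_arith effective_nth0 effective_length assms
        effective_comp[OF assms(1)] effective_comp[OF assms(2)])
  then show ?thesis by (simp only: eq)
qed

lemma effective_list_decode:
  "effective b u \<Longrightarrow> effective b (\<lambda>g x. list_encode (list_decode (u g x)))"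
  by simp

lemma effective_initial_segment:
  "effective True n \<Longrightarrow> effective True (\<lambda>g x. list_encode (initial_segment g (n g x)))"
  unfolding initial_segment_def by (intro effective_map_upt effective_oracle effective_basic)

lemma effective_member:
  assumes "computable_string_set T" "effective b (\<lambda>g x. list_encode (xs g x))"
  shows "effective b (\<lambda>g x. of_bool (xs g x \<in> T))"
proof -
  have "effective b (\<lambda>g k. of_bool (list_decode k \<in> T))"
    using assms(1) unfolding computable_string_set_def computable_list_def computable_iff_effective
    by (auto intro: effective_mono simp: of_bool_def)
  from effective_comp[OF this assms(2)] show ?thesis by simp
qed

lemmas effective_string = effective_arith effective_Cons effective_drop effective_nth0
  effective_length effective_take effective_append effective_list_decode


section \<open>Evaluation with a finite oracle\<close>

text \<open>The oracle is partial and searches range over \<open>S\<close>, so that \<^const>\<open>run\<close> and its finite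
  approximations are instances of one function which is monotone in both arguments.\<close>

primrec prun :: "prog \<Rightarrow> (nat \<rightharpoonup> nat) \<Rightarrow> nat set \<Rightarrow> nat \<Rightarrow> nat option" where
  "prun Zero p S x = Some 0"
| "prun Succ p S x = Some (Suc x)"
| "prun First p S x = Some (pr1 x)"
| "prun Second p S x = Some (pr2 x)"
| "prun Oracle p S x = p x"
| "prun (Pair c d) p S x =
     Option.bind (prun c p S x) (\<lambda>u. Option.bind (prun d p S x) (\<lambda>v. Some (prod_encode (u, v))))"
| "prun (Comp c d) p S x = Option.bind (prun d p S x) (prun c p S)"
| "prun (Prec c d) p S x = rec_nat (prun c p S (pr1 x))
     (\<lambda>m r. Option.bind r (\<lambda>v. prun d p S (prod_encode (pr1 x, prod_encode (m, v))))) (pr2 x)"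
| "prun (Mu c) p S x =
     (if \<exists>n\<in>S. prun c p S (prod_encode (x, n)) = Some 0 \<and> (\<forall>m<n. prun c p S (prod_encode (x, m)) \<noteq> None)
      then Some (LEAST n. prun c p S (prod_encode (x, n)) = Some 0) else None)"

lemma run_eq_prun: "run c g = prun c (\<lambda>n. Some (g n)) UNIV"
  by (induction c) (rule ext, simp split: prod.splits)+

text \<open>On a downward closed range the \<open>LEAST\<close> clause amounts to a condition that
  only asks for certain convergent values. In this positive form it is visibly preserved when the
  oracle or the range grows.\<close>

lemma prun_Mu_eq_Some:
  assumes "\<forall>n\<in>S. \<forall>m<n. m \<in> S"
  shows "prun (Mu c) p S x = Some n \<longleftrightarrow> n \<in> S \<and> prun c p S (prod_encode (x, n)) = Some 0 \<and>
    (\<forall>m<n. \<exists>v. prun c p S (prod_encode (x, m)) = Some (Suc v))"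
    (is "?l \<longleftrightarrow> ?r")
proof
  let ?P = "\<lambda>n. prun c p S (prod_encode (x, n)) = Some 0"
  assume ?l
  then obtain k where k: "k \<in> S" "?P k" "\<forall>m<k. prun c p S (prod_encode (x, m)) \<noteq> None"
    and n: "n = (LEAST n. ?P n)"
    by (auto split: if_splits)
  from k(2) have "?P n" "n \<le> k" unfolding n by (rule LeastI, rule Least_le)
  moreover have "\<exists>v. prun c p S (prod_encode (x, m)) = Some (Suc v)" if "m < n" for m
  proof -
    have "\<not> ?P m" using that not_less_Least unfolding n by blast
    moreover have "prun c p S (prod_encode (x, m)) \<noteq> None" using k(3) that \<open>n \<le> k\<close> by simp
    ultimately show ?thesis by (metis not0_implies_Suc not_None_eq)
  qed
  ultimately show ?r using assms k(1) by (metis le_neq_implies_less)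
next
  let ?P = "\<lambda>n. prun c p S (prod_encode (x, n)) = Some 0"
  assume r: ?r
  then have "(LEAST n. ?P n) = n"
    by (intro Least_equality) (auto simp: not_le[symmetric] dest: spec)
  moreover have "\<exists>n\<in>S. ?P n \<and> (\<forall>m<n. prun c p S (prod_encode (x, m)) \<noteq> None)"
    using r by (metis option.distinct(1))
  ultimately show ?l by simp
qed

lemma prun_mono:
  assumes "p \<subseteq>\<^sub>m q" "S \<subseteq> S'"
    and S: "\<forall>n\<in>S. \<forall>m<n. m \<in> S" and S': "\<forall>n\<in>S'. \<forall>m<n. m \<in> S'"
  shows "prun c p S x = Some v \<Longrightarrow> prun c q S' x = Some v"
proof (induction c arbitrary: x v)
  case Oracle
  then show ?case using assms(1) by (simp add: map_le_def) (metis domI)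
next
  case (Pair c d)
  from Pair.prems show ?case by (auto simp: bind_eq_Some_conv dest!: Pair.IH)
next
  case (Comp c d)
  from Comp.prems show ?case by (auto simp: bind_eq_Some_conv dest!: Comp.IH)
next
  case (Prec c d)
  let ?R = "\<lambda>p S. rec_nat (prun c p S (pr1 x))
     (\<lambda>m r. Option.bind r (\<lambda>v. prun d p S (prod_encode (pr1 x, prod_encode (m, v)))))"
  have "?R p S k = Some w \<Longrightarrow> ?R q S' k = Some w" for k w
  proof (induction k arbitrary: w)
    case 0 then show ?case by (auto dest: Prec.IH)
  next
    case (Suc k) then show ?case by (auto simp: bind_eq_Some_conv dest!: Prec.IH)
  qed
  with Prec.prems show ?case by auto
next
  case (Mu c)
  then show ?case
    unfolding prun_Mu_eq_Some[OF S] prun_Mu_eq_Some[OF S'] using assms(2) by blast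
qed auto

text \<open>The length of \<open>s\<close> bounds oracle queries and searches alike, so one string
  serves both as finite oracle and as search bound, and the result is decidable.\<close>

definition approx :: "prog \<Rightarrow> nat list \<Rightarrow> nat \<Rightarrow> nat option" where
  "approx c s = prun c (\<lambda>n. if n < length s then Some (s ! n) else None) {..<length s}"

lemma approx_mono:
  assumes "prefix s t" "approx c s x = Some v"
  shows "approx c t x = Some v"
  using assms(2) unfolding approx_def
proof (rule prun_mono[rotated -1])
  show "(\<lambda>n. if n < length s then Some (s ! n) else None)
      \<subseteq>\<^sub>m (\<lambda>n. if n < length t then Some (t ! n) else None)"
    using assms(1) by (auto simp: map_le_def prefix_def nth_append)
  show "{..<length s} \<subseteq> {..<length t}"
    using prefix_length_le[OF assms(1)] by auto
qed auto

lemma length_initial_segment [simp]: "length (initial_segment g n) = n"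
  by (simp add: initial_segment_def)

lemma nth_initial_segment [simp]: "i < n \<Longrightarrow> initial_segment g n ! i = g i"
  by (simp add: initial_segment_def)

lemma take_initial_segment: "take m (initial_segment g n) = initial_segment g (min m n)"
  by (simp add: initial_segment_def take_map min_def)

lemma prefix_initial_segment_iff:
  "prefix (initial_segment g m) (initial_segment g n) \<longleftrightarrow> m \<le> n"
proof
  assume "m \<le> n"
  then have "initial_segment g m = take m (initial_segment g n)"
    by (simp add: take_initial_segment min_def)
  then show "prefix (initial_segment g m) (initial_segment g n)" by (metis take_is_prefix)
qed (auto dest: prefix_length_le)

lemma approx_sound:
  assumes "approx c (initial_segment g n) x = Some v"
  shows "run c g x = Some v"
  using assms unfolding approx_def run_eq_prun
  by (rule prun_mono[rotated -1]) (auto simp: map_le_def split: if_splits)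

text \<open>A convergent computation uses finitely many oracle values and search steps. Its
  subcomputations may need segments of different lengths; by \<open>approx_mono\<close> the maximum
  serves them all.\<close>

lemma approx_complete:
  "run c g x = Some v \<Longrightarrow> \<exists>n. approx c (initial_segment g n) x = Some v"
proof (induction c arbitrary: x v)
  case Oracle
  then show ?case by (intro exI[of _ "Suc x"]) (simp add: approx_def)
next
  case (Pair c d)
  then obtain u w where v: "run c g x = Some u" "run d g x = Some w" "v = prod_encode (u, w)"
    by (auto simp: bind_eq_Some_conv)
  with Pair.IH obtain m n where
    "approx c (initial_segment g m) x = Some u" "approx d (initial_segment g n) x = Some w"
    by blast
  then have "approx c (initial_segment g (max m n)) x = Some u"
    "approx d (initial_segment g (max m n)) x = Some w"
    by (auto elim!: approx_mono[rotated] simp: prefix_initial_segment_iff)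
  with v(3) show ?case by (intro exI[of _ "max m n"]) (simp add: approx_def)
next
  case (Comp c d)
  then obtain u where v: "run d g x = Some u" "run c g u = Some v"
    by (auto simp: bind_eq_Some_conv)
  with Comp.IH obtain m n where
    "approx d (initial_segment g m) x = Some u" "approx c (initial_segment g n) u = Some v"
    by blast
  then have "approx d (initial_segment g (max m n)) x = Some u"
    "approx c (initial_segment g (max m n)) u = Some v"
    by (auto elim!: approx_mono[rotated] simp: prefix_initial_segment_iff)
  then show ?case by (intro exI[of _ "max m n"]) (simp add: approx_def)
next
  case (Prec c d)
  have *: "\<exists>n. approx (Prec c d) (initial_segment g n) (prod_encode (a, k)) = Some w"
    if "run (Prec c d) g (prod_encode (a, k)) = Some w" for a k w
    using that
  proof (induction k arbitrary: w)
    case 0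
    then have "run c g a = Some w" by simp
    then obtain n where "approx c (initial_segment g n) a = Some w" using Prec.IH(1) by blast
    then show ?case by (intro exI[of _ n]) (simp add: approx_def)
  next
    case (Suc k)
    then obtain u where u: "run (Prec c d) g (prod_encode (a, k)) = Some u"
      "run d g (prod_encode (a, prod_encode (k, u))) = Some w"
      by (auto simp: bind_eq_Some_conv)
    obtain m where "approx (Prec c d) (initial_segment g m) (prod_encode (a, k)) = Some u"
      using Suc.IH[OF u(1)] by blast
    moreover obtain n where
      "approx d (initial_segment g n) (prod_encode (a, prod_encode (k, u))) = Some w"
      using Prec.IH(2)[OF u(2)] by blast
    ultimately have "approx (Prec c d) (initial_segment g (max m n)) (prod_encode (a, k)) = Some u"
      "approx d (initial_segment g (max m n)) (prod_encode (a, prod_encode (k, u))) = Some w"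
      by (auto elim!: approx_mono[rotated] simp: prefix_initial_segment_iff)
    then show ?case by (intro exI[of _ "max m n"]) (simp add: approx_def)
  qed
  show ?case using *[of "pr1 x" "pr2 x" v] Prec.prems by simp
next
  case (Mu c)
  from Mu.prems have v: "run c g (prod_encode (x, v)) = Some 0"
    "\<And>m. m < v \<Longrightarrow> \<exists>w. run c g (prod_encode (x, m)) = Some (Suc w)"
    using prun_Mu_eq_Some[of UNIV c "\<lambda>n. Some (g n)" x v] unfolding run_eq_prun by blast+
  have "\<exists>N. \<forall>m\<le>v. approx c (initial_segment g N) (prod_encode (x, m)) = run c g (prod_encode (x, m))"
  proof -
    have "\<exists>N. approx c (initial_segment g N) (prod_encode (x, m)) = run c g (prod_encode (x, m))"
      if "m \<le> v" for m
      using that v Mu.IH by (metis le_neq_implies_less)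
    then obtain N where N: "\<And>m. m \<le> v \<Longrightarrow>
        approx c (initial_segment g (N m)) (prod_encode (x, m)) = run c g (prod_encode (x, m))"
      by metis
    have "approx c (initial_segment g (Max (N ` {..v}))) (prod_encode (x, m)) = run c g (prod_encode (x, m))"
      if "m \<le> v" for m
    proof -
      obtain w where w: "run c g (prod_encode (x, m)) = Some w"
        using v \<open>m \<le> v\<close> by (metis le_neq_implies_less)
      have "N m \<le> Max (N ` {..v})" using that by auto
      with N[OF that] w show ?thesis
        by (auto elim!: approx_mono[rotated] simp: prefix_initial_segment_iff)
    qed
    then show ?thesis by blast
  qed
  then obtain N where N: "\<And>m. m \<le> v \<Longrightarrow>
      approx c (initial_segment g N) (prod_encode (x, m)) = run c g (prod_encode (x, m))"
    by blast
  \<comment> \<open>The result \<open>v\<close> must itself lie in the search range below the length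
    of the segment, hence \<open>Suc v\<close>.\<close>
  let ?N = "max N (Suc v)"
  have N': "approx c (initial_segment g ?N) (prod_encode (x, m)) = run c g (prod_encode (x, m))"
    if "m \<le> v" for m
  proof -
    obtain w where w: "run c g (prod_encode (x, m)) = Some w"
      using v \<open>m \<le> v\<close> by (metis le_neq_implies_less)
    with N[OF that] show ?thesis
      by (auto elim!: approx_mono[rotated] simp: prefix_initial_segment_iff)
  qed
  have "approx (Mu c) (initial_segment g ?N) x = Some v"
    unfolding approx_def
  proof (subst prun_Mu_eq_Some, goal_cases)
    case 2
    have "\<exists>w. approx c (initial_segment g ?N) (prod_encode (x, m)) = Some (Suc w)" if "m < v" for m
      using N'[of m] v(2)[OF that] that by simp
    with N'[of v] v(1) show ?case by (simp add: approx_def)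
  qed auto
  then show ?case by blast
qed (auto simp: approx_def)

section \<open>Computability of the finite approximations\<close>

definition opt_encode :: "nat option \<Rightarrow> nat" where
  "opt_encode r = (case r of None \<Rightarrow> 0 | Some v \<Rightarrow> Suc v)"

lemma opt_encode_simps [simp]:
  "opt_encode None = 0" "opt_encode (Some v) = Suc v" "opt_encode r = 0 \<longleftrightarrow> r = None"
  by (auto simp: opt_encode_def split: option.splits)

lemma approx_simps:
  "approx Zero s x = Some 0" "approx Succ s x = Some (Suc x)"
  "approx First s x = Some (pr1 x)" "approx Second s x = Some (pr2 x)"
  "approx Oracle s x = (if x < length s then Some (s ! x) else None)"
  "approx (Pair c d) s x =
     Option.bind (approx c s x) (\<lambda>u. Option.bind (approx d s x) (\<lambda>v. Some (prod_encode (u, v))))"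
  "approx (Comp c d) s x = Option.bind (approx d s x) (approx c s)"
  "approx (Prec c d) s x = rec_nat (approx c s (pr1 x))
     (\<lambda>m r. Option.bind r (\<lambda>v. approx d s (prod_encode (pr1 x, prod_encode (m, v))))) (pr2 x)"
  by (auto simp: approx_def)

text \<open>The test \<open>\<le> 1\<close> captures divergence (code 0) and the value 0 (code 1).
  The search stops at the first such argument or at \<open>length s\<close>; it succeeds exactly
  when it stops below that bound at a convergent value.\<close>

lemma approx_Mu:
  fixes c s x
  defines "m \<equiv> LEAST n. length s \<le> n \<or> opt_encode (approx c s (prod_encode (x, n))) \<le> 1"
  shows "opt_encode (approx (Mu c) s x) =
    (if m < length s \<and> \<not> opt_encode (approx c s (prod_encode (x, m))) = 0 then Suc m else 0)"
proof -
  let ?A = "\<lambda>n. approx c s (prod_encode (x, n))"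
  let ?P = "\<lambda>n. length s \<le> n \<or> opt_encode (?A n) \<le> 1"
  have m: "?P m" unfolding m_def by (rule LeastI[of _ "length s"]) simp
  have less_m: "n < length s \<and> (\<exists>v. ?A n = Some (Suc v))" if "n < m" for n
  proof -
    have "\<not> ?P n" using that unfolding m_def by (rule not_less_Least)
    then show ?thesis by (cases "?A n") (auto simp: not_le gr0_conv_Suc)
  qed
  have iff: "approx (Mu c) s x = Some n \<longleftrightarrow> n < length s \<and> ?A n = Some 0 \<and>
      (\<forall>k<n. \<exists>v. ?A k = Some (Suc v))" for n
    unfolding approx_def by (subst prun_Mu_eq_Some) auto
  show ?thesis
  proof (cases "m < length s \<and> ?A m \<noteq> None")
    case True
    with m have "?A m = Some 0" by (auto simp: opt_encode_def split: option.splits)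
    with True less_m have "approx (Mu c) s x = Some m" unfolding iff by auto
    with True show ?thesis by simp
  next
    case False
    have "approx (Mu c) s x \<noteq> Some n" for n
    proof
      assume "approx (Mu c) s x = Some n"
      then have n: "n < length s" "?A n = Some 0" "\<forall>k<n. \<exists>v. ?A k = Some (Suc v)"
        unfolding iff by auto
      then have "\<not> n < m" using less_m by fastforce
      moreover have "\<not> m < n" using n m by fastforce
      ultimately show False using n False by (metis linorder_neqE_nat option.distinct(1))
    qed
    then have "approx (Mu c) s x = None" by (cases "approx (Mu c) s x") auto
    with False show ?thesis by auto
  qed
qed

text \<open>Induction on the program, each constructor being translated into an operation on codes.
  \<open>s\<close> and \<open>u\<close> are arbitrary because subprograms run on results of others
  and with a recursion or search variable as extra parameter.\<close>

lemma effective_approx: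
  assumes "effective b (\<lambda>g x. list_encode (s g x))" "effective b u"
  shows "effective b (\<lambda>g x. opt_encode (approx c (s g x) (u g x)))"
  using assms
proof (induction c arbitrary: s u)
  case Zero then show ?case by (simp add: approx_simps effective_basic)
next
  case Succ then show ?case by (simp add: approx_simps effective_basic)
next
  case First then show ?case by (simp add: approx_simps effective_basic)
next
  case Second then show ?case by (simp add: approx_simps effective_basic)
next
  case Oracle
  have eq: "opt_encode (approx Oracle t x) = (if x < length t then Suc (nth0 t x) else 0)" for t x
    by (simp add: approx_simps nth0_def)
  show ?case unfolding eq by (intro effective_string Oracle)
next
  case (Pair c d)
  have eq: "opt_encode (approx (Pair c d) t x) =
      (if opt_encode (approx c t x) = 0 \<or> opt_encode (approx d t x) = 0 then 0
       else Suc (prod_encode (opt_encode (approx c t x) - 1, opt_encode (approx d t x) - 1)))" for t x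
    by (cases "approx c t x"; cases "approx d t x") (simp_all add: approx_simps)
  show ?case unfolding eq by (intro effective_string Pair)
next
  case (Comp c d)
  have eq: "opt_encode (approx (Comp c d) t x) =
      (if opt_encode (approx d t x) = 0 then 0
       else opt_encode (approx c t (opt_encode (approx d t x) - 1)))" for t x
    by (cases "approx d t x") (simp_all add: approx_simps)
  show ?case unfolding eq by (intro effective_string Comp)
next
  case (Prec c d)
  have *: "opt_encode (rec_nat (approx c t a) (\<lambda>m r. Option.bind r
        (\<lambda>v. approx d t (prod_encode (a, prod_encode (m, v))))) n) =
      rec_nat (opt_encode (approx c t a)) (\<lambda>m r. if r = 0 then 0
        else opt_encode (approx d t (prod_encode (a, prod_encode (m, r - 1))))) n"
      (is "opt_encode (?R n) = ?R' n") for t a n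
  proof (induction n)
    case (Suc n)
    \<comment> \<open>The induction hypothesis is used from right to left: it replaces the recursion
      on codes by \<open>opt_encode\<close> of the value that the case distinction is about.\<close>
    then show ?case by (cases "?R n") (simp_all flip: Suc.IH)
  qed simp
  then have eq: "opt_encode (approx (Prec c d) t x) =
      rec_nat (opt_encode (approx c t (pr1 x))) (\<lambda>m r. if r = 0 then 0
        else opt_encode (approx d t (prod_encode (pr1 x, prod_encode (m, r - 1))))) (pr2 x)" for t x
    by (simp add: approx_simps)
  show ?case unfolding eq
    by (intro effective_string effective_rec_nat Prec effective_comp[OF Prec.prems(1)]
        effective_comp[OF Prec.prems(2)])
next
  case (Mu c)
  show ?case unfolding approx_Mu
    by (intro effective_string effective_Least Mu effective_comp[OF Mu.prems(1)]
        effective_comp[OF Mu.prems(2)]) auto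
qed


section \<open>Output strings on a finite oracle\<close>

definition out_length :: "prog \<Rightarrow> nat list \<Rightarrow> nat" where
  "out_length c s = (LEAST k. length s \<le> k \<or> approx c s k = None)"

text \<open>Below \<open>out_length\<close> every code is positive, so subtracting 1 recovers the
  value. The cut at \<open>length s\<close> keeps the string finite and rises with \<open>s\<close>,
  so nothing is lost in the limit.\<close>

definition out :: "prog \<Rightarrow> nat list \<Rightarrow> nat list" where
  "out c s = map (\<lambda>k. opt_encode (approx c s k) - 1) [0..<out_length c s]"

lemma effective_out:
  assumes "effective b (\<lambda>g x. list_encode (s g x))"
  shows "effective b (\<lambda>g x. list_encode (out c (s g x)))"
  unfolding out_def out_length_def opt_encode_simps(3)[symmetric]
  by (intro effective_string effective_map_upt effective_Least effective_approx
      effective_comp[OF assms] assms) auto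

lemma le_length_out_iff:
  "n \<le> length (out c s) \<longleftrightarrow> n \<le> length s \<and> (\<forall>k<n. approx c s k \<noteq> None)"
proof -
  let ?P = "\<lambda>k. length s \<le> k \<or> approx c s k = None"
  have L: "?P (out_length c s)"
    unfolding out_length_def by (rule LeastI[of _ "length s"]) simp
  have "n \<le> out_length c s" if "n \<le> length s" "\<forall>k<n. approx c s k \<noteq> None"
    using L that by (meson le_trans not_le)
  moreover have "n \<le> length s \<and> (\<forall>k<n. approx c s k \<noteq> None)" if "n \<le> out_length c s"
  proof -
    have "\<not> ?P k" if "k < n" for k
      using that \<open>n \<le> out_length c s\<close> not_less_Least[of k ?P] unfolding out_length_def by simp
    then show ?thesis by (metis le_refl not_le)
  qed
  ultimately show ?thesis by (auto simp: out_def)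
qed

lemma nth_out: "k < length (out c s) \<Longrightarrow> approx c s k = Some (out c s ! k)"
  using le_length_out_iff[of "Suc k" c s] by (auto simp: out_def)

lemma prefixI_nth:
  assumes "length xs \<le> length ys" "\<And>i. i < length xs \<Longrightarrow> xs ! i = ys ! i"
  shows "prefix xs ys"
proof -
  have "take (length xs) ys = xs" using assms by (intro nth_equalityI) auto
  then show ?thesis by (metis take_is_prefix)
qed

lemma prefix_out:
  assumes "prefix s t" shows "prefix (out c s) (out c t)"
proof (rule prefixI_nth)
  have t: "approx c t i = Some (out c s ! i)" if "i < length (out c s)" for i
    using nth_out[OF that] approx_mono[OF assms] by simp
  then show "length (out c s) \<le> length (out c t)"
    unfolding le_length_out_iff using le_length_out_iff[of "length (out c s)" c s]
      prefix_length_le[OF assms] by auto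
  then show "out c s ! i = out c t ! i" if "i < length (out c s)" for i
    using t[OF that] nth_out[of i c t] that by simp
qed

definition initial :: "nat list \<Rightarrow> baire \<Rightarrow> bool" where
  "initial s f \<longleftrightarrow> s = initial_segment f (length s)"

lemma initial_iff_nth: "initial s f \<longleftrightarrow> (\<forall>i<length s. s ! i = f i)"
  unfolding initial_def by (auto simp: list_eq_iff_nth_eq)

lemma initial_initial_segment [simp]: "initial (initial_segment f n) f"
  by (simp add: initial_def)

lemma initial_out:
  assumes "functional_of c g = Some h" "initial s g"
  shows "initial (out c s) h"
  unfolding initial_iff_nth
proof (intro allI impI)
  fix i assume "i < length (out c s)"
  then have "run c g i = Some (out c s ! i)"
    using assms(2) nth_out approx_sound unfolding initial_def by metis
  moreover have "run c g i = Some (h i)"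
    using assms(1) by (auto simp: functional_of_def split: if_splits)
  ultimately show "out c s ! i = h i" by simp
qed

lemma out_unbounded:
  assumes "functional_of c g = Some h"
  shows "\<exists>n. m \<le> length (out c (initial_segment g n))"
proof -
  have "run c g i = Some (h i)" for i
    using assms by (auto simp: functional_of_def split: if_splits)
  then have "\<exists>n. approx c (initial_segment g n) i = Some (h i)" for i
    by (rule approx_complete)
  then obtain N where N: "\<And>i. approx c (initial_segment g (N i)) i = Some (h i)"
    by metis
  \<comment> \<open>The output is never longer than the oracle string, so \<open>m\<close> joins the
    stages at which the first \<open>m\<close> values converge.\<close>
  let ?n = "Max (insert m (N ` {..<m}))"
  have "approx c (initial_segment g ?n) i = Some (h i)" if "i < m" for i
    by (rule approx_mono[OF _ N]) (use that in \<open>simp add: prefix_initial_segment_iff\<close>)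
  moreover have "m \<le> ?n" by simp
  ultimately show ?thesis unfolding le_length_out_iff by (intro exI[of _ ?n]) simp
qed

section \<open>Leaving the tree and starting again\<close>

definition binary :: "nat list \<Rightarrow> bool" where
  "binary s \<longleftrightarrow> (\<forall>i<length s. nth0 s i \<le> 1)"

definition exit_string :: "nat list set \<Rightarrow> nat list \<Rightarrow> bool" where
  "exit_string T s \<longleftrightarrow> binary s \<and> s \<notin> T \<and> (\<forall>m<length s. take m s \<in> T)"

definition restart :: "nat list set \<Rightarrow> baire set" where
  "restart T = {f \<in> cantor. f \<in> paths T \<or>
     (\<exists>n. exit_string T (initial_segment f n) \<and> (\<lambda>i. f (n + i)) \<in> paths T)}"

lemma effective_binary:
  assumes "effective b (\<lambda>g x. list_encode (s g x))"
  shows "effective b (\<lambda>g x. of_bool (binary (s g x)))"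
  unfolding binary_def
  by (intro effective_ball effective_string effective_comp[OF assms] assms)

lemma effective_exit_string:
  assumes "computable_string_set T" "effective b (\<lambda>g x. list_encode (s g x))"
  shows "effective b (\<lambda>g x. of_bool (exit_string T (s g x)))"
  unfolding exit_string_def
  by (intro effective_ball effective_string effective_binary effective_member
      effective_comp[OF assms(2)] assms)

lemma binary_initial_segment: "f \<in> cantor \<Longrightarrow> binary (initial_segment f n)"
  by (auto simp: binary_def nth0_def cantor_def) (metis One_nat_def le_SucI le_refl zero_le)

lemma cantorI:
  assumes "\<And>n. binary (initial_segment f n)"
  shows "f \<in> cantor"
proof -
  have "f n \<le> 1" for n
    using assms[of "Suc n"] by (auto simp: binary_def nth0_def)
  then show ?thesis by (auto simp: cantor_def le_Suc_eq)
qed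

lemma binary_appendD:
  assumes "binary (s @ t)" shows "binary s"
proof -
  have "nth0 s i = nth0 (s @ t) i" if "i < length s" for i
    using that by (simp add: nth0_def nth_append)
  with assms show ?thesis by (simp add: binary_def)
qed

lemma tree_prefix: "is_tree T \<Longrightarrow> prefix s t \<Longrightarrow> t \<in> T \<Longrightarrow> s \<in> T"
  unfolding is_tree_def prefix_def by blast

lemma initial_in_tree: "is_tree T \<Longrightarrow> f \<in> paths T \<Longrightarrow> initial s f \<Longrightarrow> s \<in> T"
  unfolding initial_def paths_def by (metis mem_Collect_eq)

lemma drop_initial_segment:
  "drop m (initial_segment f n) = initial_segment (\<lambda>i. f (m + i)) (n - m)"
  by (rule nth_equalityI) auto

text \<open>The witnessing tree \<open>?U\<close> cuts a binary string at its first departure from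
  \<open>T\<close> and requires the remainder to lie in \<open>T\<close>. Without a departure the
  cut is at \<open>Suc (length s)\<close> and the remainder is \<open>[]\<close>, which is where
  \<open>[] \<in> T\<close> enters.\<close>

lemma Pi01_restart:
  assumes T: "computable_string_set T" "is_tree T" and "[] \<in> T" "paths T \<subseteq> cantor"
  shows "Pi01 (restart T)"
proof -
  let ?l = "\<lambda>s. LEAST m. length s < m \<or> take m s \<notin> T"
  have l: "length s < ?l s \<or> take (?l s) s \<notin> T" for s
    by (rule LeastI[of _ "Suc (length s)"]) simp
  have l_le: "?l s \<le> m" if "take m s \<notin> T" for m s
    by (rule Least_le) (use that in simp)
  have less_l: "take m s \<in> T" if "m < ?l s" for m s
    using not_less_Least[OF that] by simp
  let ?U = "{s. binary s \<and> drop (?l s) s \<in> T}"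
  have "effective False (\<lambda>g x. of_bool (binary (list_decode x) \<and>
      drop (LEAST m. length (list_decode x) < m \<or> take m (list_decode x) \<notin> T) (list_decode x) \<in> T))"
    by (intro effective_string effective_member effective_binary effective_Least T)
      (auto intro: exI[of _ "Suc _"])
  then have "computable_string_set ?U"
    unfolding computable_string_set_def computable_list_def computable_iff_effective of_bool_def by simp
  moreover have "is_tree ?U"
    unfolding is_tree_def
  proof (intro allI impI)
    fix s t assume st: "s @ t \<in> ?U"
    have "binary s" by (rule binary_appendD) (rule conjunct1[OF st[unfolded mem_Collect_eq]])
    moreover have "drop (?l s) s \<in> T"
    proof (cases "length s < ?l s")
      case False
      with l[of s] have *: "take (?l s) s \<notin> T" by simp
      \<comment> \<open>Once \<open>s\<close> has left the tree, extending it does not move the exit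
        position, so the remainder of \<open>s\<close> is a prefix of that of
        \<open>s @ t\<close>.\<close>
      have "?l (s @ t) = ?l s"
      proof (rule Least_equality)
        show "length (s @ t) < ?l s \<or> take (?l s) (s @ t) \<notin> T" using False * by simp
        fix m assume m: "length (s @ t) < m \<or> take m (s @ t) \<notin> T"
        show "?l s \<le> m"
        proof (rule ccontr)
          assume "\<not> ?l s \<le> m"
          with m less_l[of m s] False show False by simp
        qed
      qed
      with st False have "drop (?l s) s @ t \<in> T" by simp
      with T(2) show ?thesis unfolding is_tree_def by blast
    qed (simp add: assms)
    ultimately show "s \<in> ?U" by simp
  qed
  moreover have "restart T = paths ?U"
  proof (intro set_eqI iffI)
    fix f assume f: "f \<in> restart T"
    then have "f \<in> cantor" by (simp add: restart_def)
    have "initial_segment f N \<in> ?U" for N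
    proof (cases "N < ?l (initial_segment f N)")
      case False
      let ?s = "initial_segment f N"
      have *: "take (?l ?s) ?s \<notin> T" using l[of ?s] False by simp
      then have "f \<notin> paths T" by (auto simp: take_initial_segment paths_def)
      with f obtain n where n: "exit_string T (initial_segment f n)" "(\<lambda>i. f (n + i)) \<in> paths T"
        by (auto simp: restart_def)
      have "n \<le> ?l ?s"
      proof (rule ccontr)
        assume "\<not> n \<le> ?l ?s"
        with n(1) False have "take (?l ?s) (initial_segment f n) \<in> T"
          by (simp add: exit_string_def)
        with * False \<open>\<not> n \<le> ?l ?s\<close> show False by (simp add: take_initial_segment min_def)
      qed
      then have "?l ?s = n"
        using l_le[of n ?s] n(1) False by (simp add: take_initial_segment exit_string_def min_def)
      with n(2) \<open>f \<in> cantor\<close> show ?thesis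
        by (simp add: drop_initial_segment paths_def binary_initial_segment)
    qed (simp add: assms \<open>f \<in> cantor\<close> binary_initial_segment)
    then show "f \<in> paths ?U" by (simp add: paths_def)
  next
    fix f assume f: "f \<in> paths ?U"
    then have "f \<in> cantor" by (intro cantorI) (simp add: paths_def)
    moreover have "\<exists>n. exit_string T (initial_segment f n) \<and> (\<lambda>i. f (n + i)) \<in> paths T"
      if "f \<notin> paths T"
    proof -
      define n where "n = (LEAST n. initial_segment f n \<notin> T)"
      have n: "initial_segment f n \<notin> T"
        using that LeastI_ex[of "\<lambda>n. initial_segment f n \<notin> T"] unfolding n_def paths_def by blast
      have less_n: "initial_segment f m \<in> T" if "m < n" for m
        using not_less_Least[of m "\<lambda>n. initial_segment f n \<notin> T"] that unfolding n_def by blast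
      have "initial_segment (\<lambda>i. f (n + i)) k \<in> T" for k
      proof -
        \<comment> \<open>The segment of length \<open>n + k\<close> leaves \<open>T\<close> at
          \<open>n\<close>, so its membership in \<open>?U\<close> puts the last \<open>k\<close>
          entries into \<open>T\<close>.\<close>
        have "?l (initial_segment f (n + k)) = n"
          by (rule Least_equality)
            (use n less_n in \<open>auto simp: take_initial_segment min_def not_le[symmetric]\<close>)
        moreover have "initial_segment f (n + k) \<in> ?U" using f by (simp add: paths_def)
        ultimately show ?thesis by (simp add: drop_initial_segment)
      qed
      moreover have "exit_string T (initial_segment f n)"
        using n less_n \<open>f \<in> cantor\<close>
        by (simp add: exit_string_def binary_initial_segment take_initial_segment min_def)
      ultimately show ?thesis by (auto simp: paths_def)
    qed
    ultimately show "f \<in> restart T" by (auto simp: restart_def)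
  qed
  ultimately show ?thesis unfolding Pi01_def by blast
qed

section \<open>Recovering a path with one mind change\<close>

lemma Least_exit_string:
  assumes "exit_string T (initial_segment f n)"
  shows "(LEAST n. initial_segment f n \<notin> T) = n"
proof (rule Least_equality)
  fix m assume "initial_segment f m \<notin> T"
  show "n \<le> m"
  proof (rule ccontr)
    assume "\<not> n \<le> m"
    with assms have "take m (initial_segment f n) \<in> T" by (simp add: exit_string_def)
    with \<open>\<not> n \<le> m\<close> \<open>initial_segment f m \<notin> T\<close> show False
      by (simp add: take_initial_segment min_def)
  qed
qed (use assms in \<open>simp add: exit_string_def\<close>)

lemma exit_string_in_tree_iff:
  assumes "exit_string T (initial_segment f n)" "is_tree T"
  shows "initial_segment f m \<in> T \<longleftrightarrow> m < n"
proof
  assume "m < n"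
  with assms(1) have "take m (initial_segment f n) \<in> T" by (simp add: exit_string_def)
  with \<open>m < n\<close> show "initial_segment f m \<in> T" by (simp add: take_initial_segment min_def)
next
  assume "initial_segment f m \<in> T"
  with assms show "m < n"
    unfolding exit_string_def by (meson not_le prefix_initial_segment_iff tree_prefix)
qed

lemma le_1_1_subset:
  assumes "A \<subseteq> B" shows "le_1_1 B A"
proof -
  have "functional_of Oracle g = Some g" for g by (simp add: functional_of_def)
  with assms show ?thesis
    unfolding le_1_1_def reducible_via_def computable_functional_def by fastforce
qed

text \<open>A learner that constantly names the identity program \<open>Oracle\<close> never changes
  its mind.\<close>

lemma le_1_finite_subset:
  assumes "A \<subseteq> B" shows "le_1_finite B A"
proof -
  have id: "functional_of Oracle g = Some g" for g by (simp add: functional_of_def)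
  have "learnable_bounded Some"
    unfolding learnable_bounded_def
  proof (intro exI[of _ "\<lambda>_. prog_encode Oracle"] conjI)
    show "computable_list (\<lambda>_. prog_encode Oracle)"
      unfolding computable_list_def computable_iff_effective by (rule effective_const)
  qed (simp_all add: convergent_const Phi_def inj_prog_encode id del: prog_encode.simps)
  with assms show ?thesis
    unfolding le_1_finite_def reducible_via_def by (intro exI[of _ Some]) auto
qed

text \<open>One program serves all exit positions: it finds \<open>n\<close> by searching for the
  first segment outside \<open>T\<close>, which exists on every input considered here.\<close>

lemma run_shift_program:
  assumes "computable_string_set T"
  obtains d where "\<And>g n. exit_string T (initial_segment g n) \<Longrightarrow>
    functional_of d g = Some (\<lambda>i. g (n + i))"
proof -
  have "effective True (\<lambda>g z. of_bool (initial_segment g (pr2 z) \<in> T))"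
    by (intro effective_member effective_initial_segment effective_basic assms)
  then obtain c where c: "\<And>g z. run c g z = Some (of_bool (initial_segment g (pr2 z) \<in> T))"
    unfolding effective_def by blast
  have "effective True (\<lambda>g z. g (pr2 z + pr1 z))"
    by (intro effective_oracle effective_arith)
  then obtain e where e: "\<And>g z. run e g z = Some (g (pr2 z + pr1 z))"
    unfolding effective_def by blast
  show ?thesis
  proof (rule that)
    fix g n assume n: "exit_string T (initial_segment g n)"
    have "run (Mu c) g i = Some n" for i
      using run_Mu[of c g i "\<lambda>n. initial_segment g n \<notin> T"] n
      by (auto simp: c Least_exit_string[OF n] exit_string_def simp del: run.simps)
    \<comment> \<open>The inner \<open>Pair First Second\<close> is the identity, so
      \<open>e\<close> receives the pair of \<open>i\<close> and the exit position
      \<open>n\<close>.\<close>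
    then show "functional_of (Comp e (Pair (Pair First Second) (Mu c))) g = Some (\<lambda>i. g (n + i))"
      by (simp add: functional_of_def e del: run.simps(9))
  qed
qed

text \<open>The learner names the identity program while the input stays in \<open>T\<close> and the
  shift program afterwards. A tree cannot be re-entered, so there is at most one mind
  change.\<close>

lemma le_1_finite_restart:
  assumes T: "computable_string_set T" "is_tree T"
  shows "le_1_finite (paths T) (restart T)"
proof -
  obtain d where d: "\<And>g n. exit_string T (initial_segment g n) \<Longrightarrow>
      functional_of d g = Some (\<lambda>i. g (n + i))"
    using run_shift_program[OF T(1)] by blast
  \<comment> \<open>Cutting the domain to \<open>restart T\<close> confines the conditions on the
    learner to inputs of known form.\<close>
  define \<Gamma> :: "baire \<rightharpoonup> baire" where "\<Gamma> g = (if g \<in> restart T then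
      Some (if g \<in> paths T then g else (\<lambda>i. g ((LEAST n. initial_segment g n \<notin> T) + i))) else None)" for g
  define \<Psi> where "\<Psi> s = (if s \<in> T then prog_encode Oracle else prog_encode d)" for s
  have dom: "dom \<Gamma> = restart T" by (auto simp: \<Gamma>_def dom_def)
  have Phi: "Phi (prog_encode c) = functional_of c" for c by (simp add: Phi_def inj_prog_encode)
  have *: "convergent (\<lambda>n. \<Psi> (initial_segment g n)) \<and> Phi (lim (\<lambda>n. \<Psi> (initial_segment g n))) g = \<Gamma> g \<and>
      finite {n. \<Psi> (initial_segment g (n + 1)) \<noteq> \<Psi> (initial_segment g n)} \<and>
      card {n. \<Psi> (initial_segment g (n + 1)) \<noteq> \<Psi> (initial_segment g n)} \<le> 1"
    if g: "g \<in> restart T" for g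
  proof (cases "g \<in> paths T")
    case True
    then have "\<Psi> (initial_segment g n) = prog_encode Oracle" for n by (simp add: \<Psi>_def paths_def)
    with True g show ?thesis
      by (simp add: convergent_const Phi functional_of_def \<Gamma>_def del: prog_encode.simps)
  next
    case False
    with g obtain n where n: "exit_string T (initial_segment g n)" "(\<lambda>i. g (n + i)) \<in> paths T"
      by (auto simp: restart_def)
    have \<Psi>: "\<Psi> (initial_segment g m) = (if m < n then prog_encode Oracle else prog_encode d)" for m
      by (simp add: \<Psi>_def exit_string_in_tree_iff[OF n(1) T(2)] del: prog_encode.simps)
    have "(\<lambda>n. \<Psi> (initial_segment g n)) \<longlonglongrightarrow> prog_encode d"
      by (rule tendsto_eventually, rule eventually_sequentiallyI[of n]) (simp add: \<Psi>)
    then have "convergent (\<lambda>n. \<Psi> (initial_segment g n))"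
      "lim (\<lambda>n. \<Psi> (initial_segment g n)) = prog_encode d"
      by (auto simp: convergent_def limI)
    \<comment> \<open>The guess can change only between lengths \<open>n - 1\<close> and
      \<open>n\<close>; for \<open>n = 0\<close> the set is empty.\<close>
    moreover have sub: "{m. \<Psi> (initial_segment g (m + 1)) \<noteq> \<Psi> (initial_segment g m)} \<subseteq> {n - 1}"
      by (auto simp: \<Psi> split: if_splits)
    have "finite {m. \<Psi> (initial_segment g (m + 1)) \<noteq> \<Psi> (initial_segment g m)}"
      by (rule finite_subset[OF sub]) simp
    moreover have "card {m. \<Psi> (initial_segment g (m + 1)) \<noteq> \<Psi> (initial_segment g m)} \<le> 1"
      using card_mono[OF _ sub] by simp
    ultimately show ?thesis
      using g False d[OF n(1)] by (simp add: Phi \<Gamma>_def Least_exit_string[OF n(1)])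
  qed
  have "effective False (\<lambda>g k. if list_decode k \<in> T then prog_encode Oracle else prog_encode d)"
    by (intro effective_member effective_string T)
  then have "computable_list \<Psi>"
    by (simp add: computable_list_def computable_iff_effective \<Psi>_def)
  with * have "learnable_bounded \<Gamma>"
    unfolding learnable_bounded_def dom by blast
  moreover have "the (\<Gamma> g) \<in> paths T" if "g \<in> restart T" for g
    using that by (auto simp: \<Gamma>_def restart_def Least_exit_string)
  ultimately show ?thesis
    unfolding le_1_finite_def reducible_via_def using dom by blast
qed

section \<open>No computable reduction\<close>

text \<open>The head of the list is applied first and is thus the innermost string. Consing a new
  exit string refines the innermost argument, so by monotonicity the result can only be
  extended.\<close>

definition nest :: "prog \<Rightarrow> nat list list \<Rightarrow> nat list \<Rightarrow> nat list" where
  "nest c = fold (\<lambda>s y. out c (s @ y))"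

lemma nest_simps [simp]: "nest c [] y = y" "nest c (s # ss) y = nest c ss (out c (s @ y))"
  by (simp_all add: nest_def)

lemma prefix_nest: "prefix y z \<Longrightarrow> prefix (nest c ss y) (nest c ss z)"
  by (induction ss arbitrary: y z) (simp_all add: prefix_out)

lemma effective_nest:
  assumes "effective b (\<lambda>g x. list_encode (ks g x))" "effective b (\<lambda>g x. list_encode (y g x))"
  shows "effective b (\<lambda>g x. list_encode (nest c (map list_decode (ks g x)) (y g x)))"
proof -
  \<comment> \<open>Round \<open>m\<close> reads entry \<open>m\<close> of the list, so the fold
    becomes a primitive recursion whose invariant concerns the first \<open>n\<close>
    entries.\<close>
  have *: "rec_nat (list_encode z) (\<lambda>m r. list_encode (out c (list_decode (nth0 js m) @ list_decode r))) n
      = list_encode (nest c (map list_decode (take n js)) z)" if "n \<le> length js" for n js z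
    using that by (induction n) (simp_all add: nest_def take_Suc_conv_app_nth nth0_def)
  have eq: "rec_nat (list_encode z) (\<lambda>m r. list_encode (out c (list_decode (nth0 js m) @ list_decode r)))
      (length js) = list_encode (nest c (map list_decode js) z)" for js z
    using *[of "length js" js z] by simp
  have "effective b (\<lambda>g x. rec_nat (list_encode (y g x))
      (\<lambda>m r. list_encode (out c (list_decode (nth0 (ks g x) m) @ list_decode r))) (length (ks g x)))"
    by (intro effective_rec_nat effective_out effective_append effective_list_decode
        effective_nth0 effective_length effective_basic assms effective_comp[OF assms(1)])
  then show ?thesis by (simp only: eq)
qed

text \<open>Stage \<open>t\<close> tries the single candidate \<open>pr1 t\<close>, so the recursion is total on all inputs; every
  candidate recurs infinitely often.\<close>

primrec search :: "prog \<Rightarrow> nat list set \<Rightarrow> nat \<Rightarrow> nat list" where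
  "search c T 0 = []"
| "search c T (Suc t) =
    (if exit_string T (list_decode (pr1 t)) \<and>
        length (nest c (map list_decode (search c T t)) []) <
        length (nest c (map list_decode (search c T t)) (out c (list_decode (pr1 t))))
     then pr1 t # search c T t else search c T t)"

text \<open>These are the successive approximations, with the empty string innermost; under the
  assumed reduction their limit is the computable path.\<close>

definition found :: "prog \<Rightarrow> nat list set \<Rightarrow> nat \<Rightarrow> nat list" where
  "found c T t = nest c (map list_decode (search c T t)) []"

lemma effective_found:
  assumes "computable_string_set T" "effective b u"
  shows "effective b (\<lambda>g x. list_encode (found c T (u g x)))"
proof -
  have eq: "rec_nat 0 (\<lambda>t r.
     if exit_string T (list_decode (pr1 t)) \<and>
        length (nest c (map list_decode (list_decode r)) []) <
        length (nest c (map list_decode (list_decode r)) (out c (list_decode (pr1 t))))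
     then Suc (prod_encode (pr1 t, r)) else r) t = list_encode (search c T t)" for t
    by (induction t) simp_all
  have "effective b (\<lambda>g x. list_encode (search c T (u g x)))"
    unfolding eq[symmetric]
    by (intro effective_rec_nat effective_string effective_exit_string effective_nest effective_out
        assms)
  then show ?thesis
    unfolding found_def by (intro effective_nest) (simp_all add: effective_const)
qed

lemma prefix_found: "t \<le> t' \<Longrightarrow> prefix (found c T t) (found c T t')"
proof (induction t' rule: dec_induct)
  case (step n)
  have "prefix (found c T n) (found c T (Suc n))"
    by (simp add: found_def prefix_nest)
  with step.IH show ?case by (rule prefix_order.trans)
qed simp

text \<open>A stage changes the list only when this lengthens the nested output, and lengths never
  decrease.\<close>

lemma search_stable:
  "t \<le> t' \<Longrightarrow> search c T t' = search c T t \<or> length (found c T t) < length (found c T t')"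
proof (induction t' rule: dec_induct)
  case (step n)
  have "search c T (Suc n) = search c T n \<or> length (found c T n) < length (found c T (Suc n))"
    by (simp add: found_def)
  moreover have "length (found c T t) \<le> length (found c T n)"
    by (rule prefix_length_le[OF prefix_found]) fact
  ultimately show ?case using step.IH by (auto simp: found_def)
qed simp

lemma search_progress:
  assumes "exit_string T s"
    and "length (found c T t) < length (nest c (map list_decode (search c T t)) (out c s))"
  shows "\<exists>t'. length (found c T t) < length (found c T t')"
proof -
  \<comment> \<open>The first component makes stage \<open>t'\<close> try \<open>s\<close>; the
    second ensures \<open>t \<le> t'\<close>. If the list has changed in between, progress has
    already been made; otherwise \<open>s\<close> still lengthens the output.\<close>
  define t' where "t' = prod_encode (list_encode s, t)"
  have "t \<le> t'" unfolding t'_def by (rule le_prod_encode_2)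
  from search_stable[OF this] show ?thesis
  proof
    assume "search c T t' = search c T t"
    with assms have "length (found c T t) < length (found c T (Suc t'))"
      by (simp add: found_def t'_def)
    then show ?thesis ..
  qed blast
qed

lemma exit_string_search: "k \<in> set (search c T t) \<Longrightarrow> exit_string T (list_decode k)"
  by (induction t) (auto split: if_splits)

text \<open>Extend the segment of \<open>h\<close> by zeros. The result is computable, hence no path
  of \<open>T\<close>, so it leaves \<open>T\<close>; it cannot do so before length
  \<open>n\<close>, where it agrees with \<open>h\<close>.\<close>

lemma ex_exit_string:
  assumes "is_tree T" "paths T \<subseteq> cantor" "\<forall>f\<in>paths T. \<not> computable f" "h \<in> paths T"
  shows "\<exists>s. exit_string T s \<and> prefix (initial_segment h n) s"
proof -
  define f where "f = nth0 (initial_segment h n)"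
  have "effective False (\<lambda>g x. nth0 (initial_segment h n) x)"
    by (intro effective_nth0 effective_basic)
  then have "computable f" by (simp add: computable_iff_effective f_def)
  then obtain m where "initial_segment f m \<notin> T"
    using assms(3) by (auto simp: paths_def)
  define k where "k = (LEAST m. initial_segment f m \<notin> T)"
  have k: "initial_segment f k \<notin> T"
    unfolding k_def by (rule LeastI) fact
  have less_k: "initial_segment f m \<in> T" if "m < k" for m
    using not_less_Least[of m "\<lambda>n. initial_segment f n \<notin> T"] that unfolding k_def by blast
  have eq: "initial_segment f m = initial_segment h m" if "m \<le> n" for m
    by (rule nth_equalityI) (use that in \<open>auto simp: f_def nth0_def\<close>)
  have "n \<le> k"
  proof (rule ccontr)
    assume "\<not> n \<le> k"
    with eq[of k] k assms(4) show False by (simp add: paths_def)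
  qed
  moreover have "f \<in> cantor" using assms(2,4) by (auto simp: f_def nth0_def cantor_def)
  then have "exit_string T (initial_segment f k)"
    using k less_k by (simp add: exit_string_def binary_initial_segment take_initial_segment min_def)
  ultimately show ?thesis
    using eq[of n] prefix_initial_segment_iff[of f n k] by auto
qed

section \<open>Iterated outputs remain extendible\<close>

definition append_baire :: "nat list \<Rightarrow> baire \<Rightarrow> baire" where
  "append_baire s f i = (if i < length s then s ! i else f (i - length s))"

lemma initial_segment_append_baire:
  "initial_segment (append_baire s f) (length s + n) = s @ initial_segment f n"
  by (rule nth_equalityI) (auto simp: append_baire_def nth_append)

lemma append_baire_in_restart:
  assumes "exit_string T s" "f \<in> paths T" "paths T \<subseteq> cantor"
  shows "append_baire s f \<in> restart T"
proof -
  have "s ! i = 0 \<or> s ! i = 1" if "i < length s" for i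
    using assms(1) that by (auto simp: exit_string_def binary_def nth0_def le_Suc_eq)
  with assms have "append_baire s f \<in> cantor"
    by (auto simp: append_baire_def cantor_def)
  moreover have "initial_segment (append_baire s f) (length s) = s"
    using initial_segment_append_baire[of s f 0] by (simp add: initial_segment_def)
  moreover have "(\<lambda>i. append_baire s f (length s + i)) = f"
    by (auto simp: append_baire_def)
  ultimately show ?thesis
    unfolding restart_def using assms by (auto intro!: exI[of _ "length s"])
qed

text \<open>Each exit string \<open>s\<close> replaces the current path \<open>h\<close> by the
  image of \<open>s\<close> followed by \<open>h\<close>, which is again a path of \<open>T\<close>;
  hence \<open>h\<close> is arbitrary in the induction. The unboundedness clause says that the
  nested outputs determine all of \<open>f\<close>.\<close>

lemma nest_path:
  assumes red: "\<And>g. g \<in> restart T \<Longrightarrow> \<exists>f\<in>paths T. functional_of c g = Some f"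
    and "paths T \<subseteq> cantor"
  shows "\<lbrakk>\<forall>s\<in>set ss. exit_string T s; h \<in> paths T\<rbrakk> \<Longrightarrow>
    \<exists>f\<in>paths T. \<forall>n. initial (nest c ss (initial_segment h n)) f \<and>
      (\<exists>m. n \<le> length (nest c ss (initial_segment h m)))"
proof (induction ss arbitrary: h)
  case Nil
  then show ?case by (intro bexI[of _ h]) auto
next
  case (Cons s ss)
  have "append_baire s h \<in> restart T"
    by (rule append_baire_in_restart) (use Cons.prems assms(2) in auto)
  then obtain h' where h': "h' \<in> paths T" "functional_of c (append_baire s h) = Some h'"
    using red by blast
  have "\<forall>s\<in>set ss. exit_string T s" using Cons.prems(1) by simp
  from Cons.IH[OF this h'(1)] obtain f where f: "f \<in> paths T"
    "\<And>n. initial (nest c ss (initial_segment h' n)) f"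
    "\<And>n. \<exists>m. n \<le> length (nest c ss (initial_segment h' m))"
    by blast
  have out: "initial (out c (s @ initial_segment h n)) h'" for n
    by (rule initial_out[OF h'(2)]) (metis initial_initial_segment initial_segment_append_baire)
  have "\<exists>m. n \<le> length (nest c (s # ss) (initial_segment h m))" for n
  proof -
    obtain k where k: "n \<le> length (nest c ss (initial_segment h' k))" using f(3) by blast
    obtain m where "k \<le> length (out c (initial_segment (append_baire s h) m))"
      using out_unbounded[OF h'(2)] by blast
    \<comment> \<open>Lengthening the segment to \<open>length s + m\<close> brings it into the form
      \<open>s @ initial_segment h m\<close>.\<close>
    also have "\<dots> \<le> length (out c (initial_segment (append_baire s h) (length s + m)))"
      by (intro prefix_length_le prefix_out) (simp add: prefix_initial_segment_iff)
    finally have "k \<le> length (out c (s @ initial_segment h m))"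
      by (simp add: initial_segment_append_baire)
    with out[of m] have "prefix (initial_segment h' k) (out c (s @ initial_segment h m))"
      by (intro prefixI_nth) (simp_all add: initial_iff_nth)
    from prefix_length_le[OF prefix_nest[OF this, of c ss]] k show ?thesis
      by (intro exI[of _ m]) simp
  qed
  moreover have "initial (nest c (s # ss) (initial_segment h n)) f" for n
    using f(2)[of "length (out c (s @ initial_segment h n))"] out[of n] unfolding initial_def[of "out _ _"]
    by simp
  ultimately show ?case using f(1) by blast
qed

lemma not_le_1_1_restart:
  assumes T: "computable_string_set T" "is_tree T" and "paths T \<subseteq> cantor"
    and special: "special (paths T)"
  shows "\<not> le_1_1 (paths T) (restart T)"
proof
  assume "le_1_1 (paths T) (restart T)"
  then obtain c where c: "restart T \<subseteq> dom (functional_of c)"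
    "\<forall>g\<in>restart T. the (functional_of c g) \<in> paths T"
    unfolding le_1_1_def reducible_via_def computable_functional_def by blast
  then have red: "\<exists>f\<in>paths T. functional_of c g = Some f" if "g \<in> restart T" for g
    using that by force
  obtain h where h: "h \<in> paths T" using special by (auto simp: special_def)
  have nest: "\<exists>f\<in>paths T. \<forall>n. initial (nest c (map list_decode (search c T t)) (initial_segment f' n)) f \<and>
      (\<exists>m. n \<le> length (nest c (map list_decode (search c T t)) (initial_segment f' m)))"
    if "f' \<in> paths T" for t f'
    by (rule nest_path[OF red assms(3)]) (use that exit_string_search in auto)
  \<comment> \<open>\<open>found c T t\<close> is the nested output on the segment of
    \<open>h\<close> of length 0, hence an initial segment of a path of \<open>T\<close>.\<close>
  have found: "found c T t \<in> T" for t
  proof -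
    obtain f where "f \<in> paths T"
      "\<forall>n. initial (nest c (map list_decode (search c T t)) (initial_segment h n)) f"
      using nest[OF h] by blast
    then have "f \<in> paths T" "initial (found c T t) f"
      by (auto simp: found_def initial_segment_def dest: spec[of _ 0])
    with T(2) show ?thesis by (rule initial_in_tree)
  qed
  have progress: "\<exists>t'. length (found c T t) < length (found c T t')" for t
  proof -
    let ?ss = "map list_decode (search c T t)"
    \<comment> \<open>The path \<open>h\<close> is itself a legal input, with image
      \<open>h'\<close>, and long segments of \<open>h'\<close> push the nested output beyond the
      current one. An exit string extending a long enough segment of \<open>h\<close> outputs at
      least such a segment of \<open>h'\<close>.\<close>
    have "h \<in> restart T" using h assms(3) by (auto simp: restart_def)
    with red obtain h' where h': "h' \<in> paths T" "functional_of c h = Some h'" by blast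
    obtain m where m: "Suc (length (found c T t)) \<le> length (nest c ?ss (initial_segment h' m))"
      using nest[OF h'(1)] by blast
    obtain n where n: "m \<le> length (out c (initial_segment h n))"
      using out_unbounded[OF h'(2)] by blast
    obtain s where s: "exit_string T s" "prefix (initial_segment h n) s"
      using ex_exit_string[OF T(2) assms(3) _ h] special by (auto simp: special_def)
    have "prefix (initial_segment h' m) (out c (initial_segment h n))"
      using n initial_out[OF h'(2), of "initial_segment h n"]
      by (intro prefixI_nth) (simp_all add: initial_iff_nth)
    also have "prefix \<dots> (out c s)" by (rule prefix_out[OF s(2)])
    finally have "length (nest c ?ss (initial_segment h' m)) \<le> length (nest c ?ss (out c s))"
      by (intro prefix_length_le prefix_nest)
    with m have "length (found c T t) < length (nest c ?ss (out c s))" by simp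
    with s(1) show ?thesis by (rule search_progress)
  qed
  have unbounded: "\<exists>t. b < length (found c T t)" for b
  proof (induction b)
    case 0
    obtain t where "length (found c T 0) < length (found c T t)" using progress by blast
    then have "0 < length (found c T t)" by (rule le_less_trans[OF le0])
    then show ?case ..
  next
    case (Suc b)
    then obtain t where "b < length (found c T t)" by blast
    moreover obtain t' where "length (found c T t) < length (found c T t')" using progress by blast
    ultimately have "Suc b < length (found c T t')" by simp
    then show ?case ..
  qed
  \<comment> \<open>Entry \<open>b\<close> is read at the first stage whose string is longer than
    \<open>b\<close>. Unboundedness makes this search total, and as the strings extend one another,
    all of them are initial segments of \<open>x\<close>.\<close>
  define x where "x = (\<lambda>b. nth0 (found c T (LEAST t. b < length (found c T t))) b)"
  have "effective False (\<lambda>g b. nth0 (found c T (LEAST t. b < length (found c T t))) b)"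
    by (intro effective_nth0 effective_found effective_Least effective_less effective_length
        effective_basic T unbounded)
  then have "computable x" by (simp add: computable_iff_effective x_def)
  have x: "initial (found c T t) x" for t
    unfolding initial_iff_nth
  proof (intro allI impI)
    fix i assume i: "i < length (found c T t)"
    let ?t = "LEAST t. i < length (found c T t)"
    have "i < length (found c T ?t)" using i by (rule LeastI)
    moreover have "prefix (found c T ?t) (found c T t)"
      by (intro prefix_found Least_le i)
    ultimately show "found c T t ! i = x i"
      by (auto simp: x_def nth0_def prefix_def nth_append)
  qed
  have "initial_segment x n \<in> T" for n
  proof -
    obtain t where t: "n < length (found c T t)" using unbounded by blast
    then have "prefix (initial_segment x n) (found c T t)"
      using x[of t] by (intro prefixI_nth) (simp_all add: initial_iff_nth)
    with T(2) show ?thesis using found by (rule tree_prefix)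
  qed
  then have "x \<in> paths T" by (simp add: paths_def)
  with \<open>computable x\<close> special show False by (simp add: special_def)
qed

theorem corollary31:
  fixes P :: "baire set"
  assumes "P \<subseteq> cantor" and "Pi01 P" and "special P"
  shows "\<exists>Q. Q \<subseteq> cantor \<and> Pi01 Q \<and> less_1_1 Q P \<and> equiv_1_finite Q P"
proof -
  obtain T where T: "computable_string_set T" "is_tree T" "P = paths T"
    using assms(2) by (auto simp: Pi01_def)
  obtain h where "h \<in> paths T" using assms(3) T(3) by (auto simp: special_def)
  then have "initial_segment h 0 \<in> T" unfolding paths_def by blast
  \<comment> \<open>Nonemptiness of \<open>P\<close> puts the root into \<open>T\<close>, as
    \<open>Pi01_restart\<close> requires.\<close>
  then have "[] \<in> T" by (simp add: initial_segment_def)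
  have "P \<subseteq> restart T" using assms(1) T(3) by (auto simp: restart_def)
  moreover have "restart T \<subseteq> cantor" by (auto simp: restart_def)
  moreover have "Pi01 (restart T)" using Pi01_restart T \<open>[] \<in> T\<close> assms(1) by blast
  moreover have "\<not> le_1_1 P (restart T)" using not_le_1_1_restart T assms by blast
  moreover have "le_1_finite P (restart T)" using le_1_finite_restart T by blast
  ultimately show ?thesis
    unfolding less_1_1_def equiv_1_finite_def
    by (intro exI[of _ "restart T"]) (auto intro: le_1_1_subset le_1_finite_subset)
qed

end
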